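(* For each $b\in \overline B$ and each $S\in\mathcal S_1$, the inequality $\sum_{ij\in\delta^+(S)}x_{ij}\geq\sum_{i\in S}b_i$ defines a facet of $P_{\mathrm{SCF}}(b)$ if and only if $\sum_{i\in S}b_i>0$ and $S\neq N_1$.
   Context: Let $n\ge 4$, $N=\{1,\dots,n\}$, $A=\{ij : i,j\in N,\ i\ne j\}$, $N_1=N\setminus\{1\}$. $\mathcal S_1$ is the set of subsets of $N_1$ of size at least 2. For $S\subseteq N$, $\delta^+(S)=\{ij\in A : i\in S,\ j\notin S\}$ and $\delta^-(S)=\{ij\in A : i\notin S,\ j\in S\}$, with $\delta^\pm(i)=\delta^\pm(\{i\})$. $P_{\mathrm{AP}}$ is the set of $x\in[0,1]^A$ with $\sum_{j\neq i}x_{ij}=1$ and $\sum_{j\ne i}x_{ji}=1$ for all $i\in N$. $\overline B=\{b\in\mathbb R_+^{N_1} : \sum_{i\in N_1}b_i=1\}$, where $\mathbb R_+$ denotes the nonnegative reals. For $b\in\overline B$, $P_{\mathrm{SCF}}(b)$ is the projection onto the $x$ variables of the set $Q_{\mathrm{SCF}}(b)$ of $(x,f)\in P_{\mathrm{AP}}\times\mathbb R^A_+$ with $$\sum_{ij\in\delta^+(i)}f_{ij}-\sum_{ji\in\delta^-(i)}f_{ji}=-b_i\ \text{ for all } i\in N_1,\qquad f_{ij}\le x_{ij}\ \text{ for all } ij\in A.$$ *)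

theory Defs
  imports "HOL-Analysis.Analysis"
begin

text \<open>
  The node set is a finite type \<open>'n\<close>, and the distinguished node (node 1) is an arbitrary
  \<open>r :: 'n\<close>. The space of vectors indexed by the arcs is the subspace of
  \<open>real ^ ('n \<times> 'n)\<close> of the vectors that vanish off \<open>arcs\<close>.
  Facets and affine dimensions do not depend on this embedding.
\<close>

definition arcs :: "('n \<times> 'n) set" where
  "arcs = {(i, j). i \<noteq> j}"

definition arc_space :: "(real ^ ('n::finite \<times> 'n)) set" where
  "arc_space = {x. \<forall>a. a \<notin> arcs \<longrightarrow> x $ a = 0}"

definition nonroot :: "'n \<Rightarrow> 'n set" where
  "nonroot r = UNIV - {r}"

definition S1_sets :: "'n::finite \<Rightarrow> 'n set set" where
  "S1_sets r = {S. S \<subseteq> nonroot r \<and> card S \<ge> 2}"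

definition delta_out :: "'n set \<Rightarrow> ('n \<times> 'n) set" where
  "delta_out S = {(i, j) \<in> arcs. i \<in> S \<and> j \<notin> S}"

definition delta_in :: "'n set \<Rightarrow> ('n \<times> 'n) set" where
  "delta_in S = {(i, j) \<in> arcs. i \<notin> S \<and> j \<in> S}"

definition P_AP :: "(real ^ ('n::finite \<times> 'n)) set" where
  "P_AP = {x \<in> arc_space.
     (\<forall>a\<in>arcs. 0 \<le> x $ a \<and> x $ a \<le> 1) \<and>
     (\<forall>i. (\<Sum>j\<in>UNIV - {i}. x $ (i, j)) = 1) \<and>
     (\<forall>i. (\<Sum>j\<in>UNIV - {i}. x $ (j, i)) = 1)}"

text \<open>
  An element of \<open>Bbar r\<close> is a function on all nodes; its value at \<open>r\<close> is arbitrary and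
  is never used.
\<close>

definition Bbar :: "'n::finite \<Rightarrow> ('n \<Rightarrow> real) set" where
  "Bbar r = {b. (\<forall>i\<in>nonroot r. 0 \<le> b i) \<and> (\<Sum>i\<in>nonroot r. b i) = 1}"

definition Q_SCF ::
  "'n::finite \<Rightarrow> ('n \<Rightarrow> real) \<Rightarrow> ((real ^ ('n \<times> 'n)) \<times> (real ^ ('n \<times> 'n))) set" where
  "Q_SCF r b = {(x, f). x \<in> P_AP \<and> f \<in> arc_space \<and> (\<forall>a\<in>arcs. 0 \<le> f $ a) \<and>
     (\<forall>i\<in>nonroot r.
        (\<Sum>a\<in>delta_out {i}. f $ a) - (\<Sum>a\<in>delta_in {i}. f $ a) = - b i) \<and>
     (\<forall>a\<in>arcs. f $ a \<le> x $ a)}"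

definition P_SCF :: "'n::finite \<Rightarrow> ('n \<Rightarrow> real) \<Rightarrow> (real ^ ('n \<times> 'n)) set" where
  "P_SCF r b = fst ` Q_SCF r b"

text \<open>
  The inequality \<open>L x \<ge> \<beta>\<close> (with \<open>L\<close> linear) defines a facet of \<open>P\<close>: it is valid for \<open>P\<close>
  and the points of \<open>P\<close> at which it is tight form a facet of \<open>P\<close>.
\<close>

definition defines_facet ::
  "('a::euclidean_space \<Rightarrow> real) \<Rightarrow> real \<Rightarrow> 'a set \<Rightarrow> bool" where
  "defines_facet L \<beta> P \<longleftrightarrow>
     linear L \<and> (\<forall>x\<in>P. L x \<ge> \<beta>) \<and> {x \<in> P. L x = \<beta>} facet_of P"

end

theory Submission
  imports Defs
begin

text \<open>
  Validity is flow conservation: summing the balance equations over \<open>S\<close> shows that a net flow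
  of \<open>b(S)\<close> enters \<open>S\<close>, the arcs entering \<open>S\<close> carry at most their \<open>x\<close>-capacity, and in an
  assignment the capacity entering \<open>S\<close> equals the capacity leaving it. (Here \<open>b(S)\<close> is the
  total demand of \<open>S\<close>, and \<open>r\<close> supplies the total demand 1.)

  If \<open>S\<close> consists of all nodes but \<open>r\<close>, the inequality is an equation on all assignments, so it
  defines no facet. If \<open>b(S) = 0\<close>, a tight \<open>x\<close> vanishes on every arc leaving \<open>S\<close>, in particular
  on the arcs from \<open>S\<close> to \<open>r\<close>. The points that vanish on the latter arcs form a face lying
  strictly between the tight face and the whole polytope, so the tight face has codimension at
  least 2. The strictness is witnessed by an assignment that cycles through the blocks
  \<open>r\<close>, \<open>S\<close>, and the remaining nodes (\<open>cyclic_block_point\<close>), and by the uniform assignment.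

  In the remaining case \<open>b(S) > 0\<close>, it suffices that one tight point can be moved a little in
  every direction that keeps the assignment equations and tightness: then the affine hull of the
  tight face is the intersection of the affine hull of the polytope with one hyperplane, and
  the uniform assignment shows that this hyperplane cuts the dimension down by exactly 1
  (\<open>facet_of_supporting_hyperplane\<close>). The point is constant on the arcs inside \<open>S\<close>, on those
  inside the complement, and on those in between (\<open>interior_block_point\<close>).

  Membership in \<open>P_SCF\<close> of this point and its neighbours needs a flow, which is
  constructed explicitly (\<open>P_SCF_of_tight_chain\<close>). A tight cut forces the flow to
  saturate the arcs entering it and to avoid the arcs leaving it. So a chain of tight sets
  fixes the flow on all arcs except those inside the layers between consecutive sets of
  the chain. Inside a layer, what remains is a problem on a complete digraph with node demands
  of total zero, and the flow that distributes the differences of the demands evenly solves it, as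
  long as the capacities, scaled by the size of the layer, are at least these differences. That condition is strict at the chosen
  point and therefore survives small perturbations (\<open>segment_enters_P_SCF\<close>). The chain has to include
  every set that is tight throughout the neighbourhood: besides \<open>S\<close> and the set of all nodes
  but \<open>r\<close>, also \<open>{i}\<close> if a single node \<open>i\<close> carries the whole demand.
\<close>

section \<open>Cuts and assignments\<close>

lemma delta_out_Times: "delta_out S = S \<times> (- S)"
  by (auto simp: delta_out_def arcs_def)

lemma delta_in_Times: "delta_in S = (- S) \<times> S"
  by (auto simp: delta_in_def arcs_def)

lemma sum_delta_out: "(\<Sum>a\<in>delta_out S. f a) = (\<Sum>i\<in>S. \<Sum>j\<in>-S. f (i, j))"
  for S :: "'n::finite set"
  by (simp add: delta_out_Times sum.cartesian_product)

lemma sum_delta_in: "(\<Sum>a\<in>delta_in S. f a) = (\<Sum>i\<in>-S. \<Sum>j\<in>S. f (i, j))"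
  for S :: "'n::finite set"
  by (simp add: delta_in_Times sum.cartesian_product)

text \<open>
  The arcs inside \<open>S\<close> are counted once with each sign and cancel. Applied to a flow it gives the
  net supply of \<open>S\<close>; applied to an assignment, the equality of the capacities leaving and
  entering \<open>S\<close>.
\<close>

lemma net_flow_out_of_set:
  fixes f :: "'n::finite \<times> 'n \<Rightarrow> real"
  shows "(\<Sum>i\<in>S. (\<Sum>a\<in>delta_out {i}. f a) - (\<Sum>a\<in>delta_in {i}. f a))
    = (\<Sum>a\<in>delta_out S. f a) - (\<Sum>a\<in>delta_in S. f a)"
proof -
  have single: "(\<Sum>a\<in>delta_out {i}. f a) - (\<Sum>a\<in>delta_in {i}. f a)
      = (\<Sum>j\<in>UNIV. f (i, j)) - (\<Sum>j\<in>UNIV. f (j, i))" for i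
    by (simp add: sum_delta_out sum_delta_in Compl_eq_Diff_UNIV sum_diff1)
  have split: "(\<Sum>j\<in>UNIV. g j) = (\<Sum>j\<in>S. g j) + (\<Sum>j\<in>-S. g j)" for g :: "'n \<Rightarrow> real"
    by (metis Compl_partition Compl_disjoint finite sum.union_disjoint)
  have "(\<Sum>i\<in>S. \<Sum>j\<in>S. f (i, j)) = (\<Sum>i\<in>S. \<Sum>j\<in>S. f (j, i))"
    by (rule sum.swap)
  moreover have "(\<Sum>i\<in>S. \<Sum>j\<in>-S. f (j, i)) = (\<Sum>i\<in>-S. \<Sum>j\<in>S. f (i, j))"
    by (rule sum.swap)
  ultimately show ?thesis
    by (simp add: single split sum_subtractf sum.distrib sum_delta_out[of f S] sum_delta_in[of f S])
qed

text \<open>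
  The assignment equations without bounds on the variables: an affine set that contains the
  affine hull of \<open>P_SCF\<close>.
\<close>

definition assignment_flat :: "(real ^ ('n::finite \<times> 'n)) set" where
  "assignment_flat = {x \<in> arc_space.
     (\<forall>i. (\<Sum>a\<in>delta_out {i}. x $ a) = 1) \<and> (\<forall>i. (\<Sum>a\<in>delta_in {i}. x $ a) = 1)}"

text \<open>
  The upper bounds follow from the row sums, and off the arcs the entries are zero.
\<close>

lemma P_AP_eq: "P_AP = {x \<in> assignment_flat. \<forall>a. 0 \<le> x $ a}"
proof -
  have flat: "x \<in> assignment_flat \<longleftrightarrow> x \<in> arc_space \<and>
      (\<forall>i. (\<Sum>j\<in>UNIV - {i}. x $ (i, j)) = 1) \<and> (\<forall>i. (\<Sum>j\<in>UNIV - {i}. x $ (j, i)) = 1)"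
    for x :: "real ^ ('a \<times> 'a)"
    by (simp add: assignment_flat_def sum_delta_out sum_delta_in Compl_eq_Diff_UNIV)
  have le_1: "x $ a \<le> 1"
    if x: "x \<in> assignment_flat" "\<forall>a. 0 \<le> x $ a" and arc: "a \<in> arcs" for x :: "real ^ ('a \<times> 'a)" and a
  proof -
    obtain i j where a: "a = (i, j)" "j \<in> UNIV - {i}"
      using arc by (auto simp: arcs_def)
    then show ?thesis
      using member_le_sum[of j "UNIV - {i}" "\<lambda>j. x $ (i, j)"] x by (simp add: flat)
  qed
  have nonneg: "0 \<le> x $ a"
    if "x \<in> arc_space" "\<forall>a\<in>arcs. 0 \<le> x $ a" for x :: "real ^ ('a \<times> 'a)" and a
  proof (cases "a \<in> arcs")
    case True
    then show ?thesis
      using that by blast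
  next
    case False
    then have "x $ a = 0"
      using that unfolding arc_space_def by blast
    then show ?thesis
      by simp
  qed
  show ?thesis
  proof (intro set_eqI iffI)
    fix x :: "real ^ ('a \<times> 'a)"
    assume "x \<in> P_AP"
    then show "x \<in> {x \<in> assignment_flat. \<forall>a. 0 \<le> x $ a}"
      using nonneg[of x] by (simp add: P_AP_def flat del: split_paired_All)
  next
    fix x :: "real ^ ('a \<times> 'a)"
    assume "x \<in> {x \<in> assignment_flat. \<forall>a. 0 \<le> x $ a}"
    then show "x \<in> P_AP"
      using le_1[of x] by (simp add: P_AP_def flat del: split_paired_All)
  qed
qed

lemma affine_assignment_flat: "affine assignment_flat"
  unfolding affine_def assignment_flat_def arc_space_def
  by (auto simp: sum.distrib simp flip: sum_distrib_left)

lemma cut_symmetric: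
  assumes "x \<in> assignment_flat"
  shows "(\<Sum>a\<in>delta_in S. x $ a) = (\<Sum>a\<in>delta_out S. x $ a)"
  using net_flow_out_of_set[of "\<lambda>a. x $ a" S] assms by (simp add: assignment_flat_def)

definition arc_vector :: "('n \<Rightarrow> 'n \<Rightarrow> real) \<Rightarrow> real ^ ('n::finite \<times> 'n)" where
  "arc_vector g = (\<chi> a. if a \<in> arcs then g (fst a) (snd a) else 0)"

lemma arc_vector_nth: "arc_vector g $ (i, j) = (if i = j then 0 else g i j)"
  by (simp add: arc_vector_def arcs_def)

lemma arc_vector_in_P_AP:
  assumes "\<And>i j. 0 \<le> g i j"
    and "\<And>i. (\<Sum>j\<in>UNIV. g i j) = 1 + g i i"
    and "\<And>i. (\<Sum>j\<in>UNIV. g j i) = 1 + g i i"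
  shows "arc_vector g \<in> P_AP"
proof -
  have "arc_vector g \<in> arc_space"
    by (simp add: arc_space_def arc_vector_def)
  moreover have "(\<Sum>a\<in>delta_out {i}. arc_vector g $ a) = 1" for i
    using assms(2)[of i]
    by (simp add: sum_delta_out arc_vector_nth Compl_eq_Diff_UNIV sum_diff1)
  moreover have "(\<Sum>a\<in>delta_in {i}. arc_vector g $ a) = 1" for i
    using assms(3)[of i]
    by (simp add: sum_delta_in arc_vector_nth Compl_eq_Diff_UNIV sum_diff1)
  moreover have "0 \<le> arc_vector g $ a" for a
    using assms(1) by (simp add: arc_vector_def)
  ultimately show ?thesis
    by (simp add: P_AP_eq assignment_flat_def)
qed

section \<open>Flows forced by a chain of tight sets\<close>

text \<open>
  A function \<open>l\<close> encodes the chain of the sets \<open>{i. k \<le> l i}\<close>. If the flow saturates every arc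
  that goes up in \<open>l\<close> and avoids every arc that goes down, then \<open>residual l b x i\<close> is the part of the
  demand of \<open>i\<close> that must come from the nodes on the level of \<open>i\<close>.
\<close>

definition residual ::
  "('n \<Rightarrow> nat) \<Rightarrow> ('n \<Rightarrow> real) \<Rightarrow> real ^ ('n::finite \<times> 'n) \<Rightarrow> 'n \<Rightarrow> real" where
  "residual l b x i =
     b i - (\<Sum>j | l j < l i. x $ (j, i)) + (\<Sum>j | l i < l j. x $ (i, j))"

text \<open>
  The flow inside a level depends only on differences of residuals. At the points built below,
  two nodes on a level look alike from the other levels, so that these differences are just those
  of the demands.
\<close>

lemma residual_diff:
  assumes "l i = l j"
    and "\<And>k. l k \<noteq> l i \<Longrightarrow> x $ (k, i) = x $ (k, j) \<and> x $ (i, k) = x $ (j, k)"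
  shows "residual l b x j - residual l b x i = b j - b i"
proof -
  have "(\<Sum>k | l k < l i. x $ (k, i)) = (\<Sum>k | l k < l j. x $ (k, j))"
    "(\<Sum>k | l i < l k. x $ (i, k)) = (\<Sum>k | l j < l k. x $ (j, k))"
    using assms by (auto intro!: sum.cong)
  then show ?thesis
    by (simp add: residual_def)
qed

text \<open>
  The level \<open>k\<close> is the difference of two consecutive sets of the chain. Both are tight, so
  the forced flow into the level minus the forced flow out of it is already the demand of the level.
\<close>

lemma sum_residual_level:
  fixes x :: "real ^ ('n::finite \<times> 'n)"
  assumes tight: "\<And>k. 0 < k \<Longrightarrow> (\<Sum>a\<in>delta_in {i. k \<le> l i}. x $ a) = (\<Sum>i | k \<le> l i. b i)"
    and "0 < k"
  shows "(\<Sum>i | l i = k. residual l b x i) = 0"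
proof -
  have up: "{i. k \<le> l i} = {i. l i = k} \<union> {i. Suc k \<le> l i}"
    and lo: "{i. l i < Suc k} = {i. l i < k} \<union> {i. l i = k}"
    by auto
  have un: "(\<Sum>i | k \<le> l i. g i) = (\<Sum>i | l i = k. g i) + (\<Sum>i | Suc k \<le> l i. g i)"
    "(\<Sum>i | l i < Suc k. g i) = (\<Sum>i | l i < k. g i) + (\<Sum>i | l i = k. g i)" for g :: "'n \<Rightarrow> real"
    by (subst up lo, rule sum.union_disjoint; force)+
  have compl: "- {i. m \<le> l i} = {i. l i < m}" for m
    by auto
  have "(\<Sum>i | l i = k. \<Sum>j | l j < l i. x $ (j, i)) = (\<Sum>j | l j < k. \<Sum>i | l i = k. x $ (j, i))"
    by (subst sum.swap) (auto intro!: sum.cong)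
  moreover have "(\<Sum>i | l i = k. \<Sum>j | l i < l j. x $ (i, j))
      = (\<Sum>i | l i = k. \<Sum>j | Suc k \<le> l j. x $ (i, j))"
    by (auto intro!: sum.cong)
  ultimately have "(\<Sum>i | l i = k. residual l b x i) =
      (\<Sum>i | l i = k. b i) - (\<Sum>j | l j < k. \<Sum>i | l i = k. x $ (j, i))
      + (\<Sum>i | l i = k. \<Sum>j | Suc k \<le> l j. x $ (i, j))"
    by (simp add: residual_def sum.distrib sum_subtractf)
  moreover have "(\<Sum>j | l j < k. \<Sum>i | l i = k. x $ (j, i))
        + (\<Sum>j | l j < k. \<Sum>i | Suc k \<le> l i. x $ (j, i))
      = (\<Sum>i | l i = k. b i) + (\<Sum>i | Suc k \<le> l i. b i)"
    using tight[OF \<open>0 < k\<close>] by (simp only: sum_delta_in compl un(1) sum.distrib)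
  moreover have "(\<Sum>j | l j < k. \<Sum>i | Suc k \<le> l i. x $ (j, i))
        + (\<Sum>j | l j = k. \<Sum>i | Suc k \<le> l i. x $ (j, i)) = (\<Sum>i | Suc k \<le> l i. b i)"
    using tight[of "Suc k"] by (simp only: sum_delta_in compl un(2) zero_less_Suc)
  ultimately show ?thesis
    by linarith
qed

text \<open>
  Inside a level with \<open>c\<close> nodes and residuals \<open>d\<close> of total zero, the antisymmetric function
  \<open>(d j - d i) / c\<close> on the pairs \<open>(i, j)\<close> has net inflow \<open>d j\<close> at \<open>j\<close>. Sending its positive part along
  each arc gives a nonnegative flow with the same net inflow.
\<close>

lemma P_SCF_of_tight_chain:
  fixes x :: "real ^ ('n::finite \<times> 'n)" and l :: "'n \<Rightarrow> nat"
  assumes x: "x \<in> P_AP"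
    and root: "\<And>i. i \<noteq> r \<Longrightarrow> 0 < l i"
    and tight: "\<And>k. 0 < k \<Longrightarrow> (\<Sum>a\<in>delta_in {i. k \<le> l i}. x $ a) = (\<Sum>i | k \<le> l i. b i)"
    and slack: "\<And>i j. i \<noteq> j \<Longrightarrow> l i = l j \<Longrightarrow>
        residual l b x j - residual l b x i \<le> card {k. l k = l i} * x $ (i, j)"
  shows "x \<in> P_SCF r b"
proof -
  define d where "d = residual l b x"
  define c where "c i = real (card {k. l k = l i})" for i
  define f where "f = arc_vector (\<lambda>i j. if l i < l j then x $ (i, j)
     else if l i = l j then max 0 ((d j - d i) / c i) else 0)"
  have c_pos: "0 < c i" for i
    by (auto simp: c_def card_gt_0_iff)
  have x_nonneg: "0 \<le> x $ a" for a
    using x unfolding P_AP_eq by blast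
  have f_arcs: "f \<in> arc_space"
    by (simp add: f_def arc_vector_def arc_space_def)
  have f_bounds: "0 \<le> f $ a \<and> f $ a \<le> x $ a" for a
  proof (cases a)
    case (Pair i j)
    show ?thesis
      using x_nonneg[of "(i, j)"] slack[of i j] c_pos[of i]
      by (auto simp: Pair f_def arc_vector_nth d_def c_def pos_divide_le_eq mult.commute)
  qed
  have balance: "(\<Sum>a\<in>delta_out {j}. f $ a) - (\<Sum>a\<in>delta_in {j}. f $ a) = - b j" if "j \<noteq> r" for j
  proof -
    have "(\<Sum>a\<in>delta_in {j}. f $ a) - (\<Sum>a\<in>delta_out {j}. f $ a)
        = (\<Sum>i\<in>UNIV. f $ (i, j) - f $ (j, i))"
      by (simp add: sum_delta_out sum_delta_in Compl_eq_Diff_UNIV sum_diff1 sum_subtractf)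
    also have "\<dots> = (\<Sum>i\<in>UNIV. (if l i < l j then x $ (i, j) else 0)
        - (if l j < l i then x $ (j, i) else 0) + (if l i = l j then (d j - d i) / c j else 0))"
    proof (rule sum.cong[OF refl])
      fix i
      have max_diff: "max 0 ((d j - d i) / c j) - max 0 ((d i - d j) / c j) = (d j - d i) / c j"
        using c_pos[of j] by (simp add: max_def zero_le_divide_iff diff_divide_distrib)
      show "f $ (i, j) - f $ (j, i) = (if l i < l j then x $ (i, j) else 0)
        - (if l j < l i then x $ (j, i) else 0) + (if l i = l j then (d j - d i) / c j else 0)"
      proof (cases "l i = l j")
        case True
        then have "c i = c j"
          by (simp add: c_def)
        then show ?thesis
          using True max_diff by (cases "i = j") (simp_all add: f_def arc_vector_nth)
      next
        case False
        then show ?thesis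
          by (cases "l i < l j") (auto simp: f_def arc_vector_nth)
      qed
    qed
    also have "\<dots> = (\<Sum>i | l i < l j. x $ (i, j)) - (\<Sum>i | l j < l i. x $ (j, i))
        + (\<Sum>i | l i = l j. (d j - d i) / c j)"
      by (simp add: sum.distrib sum_subtractf sum.If_cases)
    also have "(\<Sum>i | l i = l j. (d j - d i) / c j) = d j - (\<Sum>i | l i = l j. d i) / c j"
    proof -
      have "(\<Sum>i | l i = l j. (d j - d i) / c j) = (c j * d j - (\<Sum>i | l i = l j. d i)) / c j"
        by (simp add: sum_subtractf c_def flip: sum_divide_distrib)
      then show ?thesis
        using c_pos[of j] by (simp add: diff_divide_distrib)
    qed
    also have "(\<Sum>i | l i = l j. d i) = 0"
      unfolding d_def by (rule sum_residual_level[OF tight root[OF that]])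
    finally show ?thesis
      by (simp add: d_def residual_def)
  qed
  have "(x, f) \<in> Q_SCF r b"
    using x f_arcs f_bounds balance by (simp add: Q_SCF_def nonroot_def)
  then have "fst (x, f) \<in> P_SCF r b"
    unfolding P_SCF_def by (rule imageI)
  then show ?thesis
    by simp
qed

lemma P_SCF_subset: "P_SCF r b \<subseteq> P_AP"
  by (auto simp: P_SCF_def Q_SCF_def)

section \<open>Validity and convexity\<close>

lemma cut_valid:
  assumes x: "x \<in> P_SCF r b" and S: "S \<subseteq> nonroot r"
  shows "(\<Sum>i\<in>S. b i) \<le> (\<Sum>a\<in>delta_out S. x $ a)"
proof -
  obtain f where xf: "(x, f) \<in> Q_SCF r b"
    using x by (auto simp: P_SCF_def)
  have "(\<Sum>i\<in>S. b i) = (\<Sum>a\<in>delta_in S. f $ a) - (\<Sum>a\<in>delta_out S. f $ a)"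
  proof -
    have "(\<Sum>i\<in>S. (\<Sum>a\<in>delta_out {i}. f $ a) - (\<Sum>a\<in>delta_in {i}. f $ a)) = (\<Sum>i\<in>S. - b i)"
      using xf S by (intro sum.cong) (auto simp: Q_SCF_def)
    then show ?thesis
      by (simp add: net_flow_out_of_set sum_negf)
  qed
  also have "\<dots> \<le> (\<Sum>a\<in>delta_in S. f $ a)"
    using xf by (auto simp: Q_SCF_def delta_out_def intro!: sum_nonneg)
  also have "\<dots> \<le> (\<Sum>a\<in>delta_in S. x $ a)"
    using xf by (auto simp: Q_SCF_def delta_in_def intro!: sum_mono)
  also have "\<dots> = (\<Sum>a\<in>delta_out S. x $ a)"
    using x P_SCF_subset by (intro cut_symmetric) (auto simp: P_AP_eq)
  finally show ?thesis .
qed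

lemma convex_P_SCF: "convex (P_SCF r b)"
proof -
  have "convex (Q_SCF r b)"
  proof (rule convexI)
    fix p q :: "(real ^ ('a \<times> 'a)) \<times> (real ^ ('a \<times> 'a))" and u v :: real
    assume p: "p \<in> Q_SCF r b" and q: "q \<in> Q_SCF r b" and uv: "0 \<le> u" "0 \<le> v" "u + v = 1"
    obtain x f y g where pq: "p = (x, f)" "q = (y, g)"
      by (cases p, cases q)
    have "u *\<^sub>R x + v *\<^sub>R y \<in> assignment_flat"
      using p q uv affine_assignment_flat by (auto simp: pq Q_SCF_def P_AP_eq affine_def)
    then have "u *\<^sub>R x + v *\<^sub>R y \<in> P_AP"
      using p q uv by (auto simp: pq Q_SCF_def P_AP_eq)
    moreover have "u *\<^sub>R f + v *\<^sub>R g \<in> arc_space"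
      using p q by (auto simp: pq Q_SCF_def arc_space_def)
    moreover have "u * f $ a + v * g $ a \<le> u * x $ a + v * y $ a" if "a \<in> arcs" for a
      using p q uv that by (auto simp: pq Q_SCF_def intro!: add_mono mult_left_mono)
    moreover have "(\<Sum>a\<in>delta_out {i}. u * f $ a + v * g $ a)
        - (\<Sum>a\<in>delta_in {i}. u * f $ a + v * g $ a) = - b i" if "i \<in> nonroot r" for i
    proof -
      have "(\<Sum>a\<in>delta_out {i}. u * f $ a + v * g $ a)
        - (\<Sum>a\<in>delta_in {i}. u * f $ a + v * g $ a)
        = u * ((\<Sum>a\<in>delta_out {i}. f $ a) - (\<Sum>a\<in>delta_in {i}. f $ a))
          + v * ((\<Sum>a\<in>delta_out {i}. g $ a) - (\<Sum>a\<in>delta_in {i}. g $ a))"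
        by (simp add: sum.distrib sum_distrib_left algebra_simps)
      also have "\<dots> = (u + v) * (- b i)"
        using p q that by (simp add: pq Q_SCF_def distrib_right)
      finally show ?thesis
        using uv by simp
    qed
    ultimately show "u *\<^sub>R p + v *\<^sub>R q \<in> Q_SCF r b"
      using p q uv by (auto simp: pq Q_SCF_def)
  qed
  then show ?thesis
    unfolding P_SCF_def by (intro convex_linear_image linear_fst)
qed

section \<open>Points of the polytope\<close>

lemma Bbar_sum_bounds:
  assumes "b \<in> Bbar r" "T \<subseteq> nonroot r"
  shows "0 \<le> (\<Sum>i\<in>T. b i)" "(\<Sum>i\<in>T. b i) \<le> 1"
proof -
  show "0 \<le> (\<Sum>i\<in>T. b i)"
    using assms by (auto simp: Bbar_def intro!: sum_nonneg)
  have "(\<Sum>i\<in>T. b i) \<le> (\<Sum>i\<in>nonroot r. b i)"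
    using assms by (intro sum_mono2) (auto simp: Bbar_def)
  then show "(\<Sum>i\<in>T. b i) \<le> 1"
    using assms by (simp add: Bbar_def)
qed

lemma Bbar_le_sum:
  assumes "b \<in> Bbar r" "T \<subseteq> nonroot r" "i \<in> T"
  shows "0 \<le> b i" "b i \<le> (\<Sum>i\<in>T. b i)"
  using assms member_le_sum[of i T b] by (auto simp: Bbar_def)

text \<open>
  The levels of the chain consisting of all nodes but \<open>r\<close>, then \<open>S\<close>, then \<open>T\<close>, where \<open>S\<close> and
  \<open>T\<close> may be empty.
\<close>

definition layer :: "'n \<Rightarrow> 'n set \<Rightarrow> 'n set \<Rightarrow> 'n \<Rightarrow> nat" where
  "layer r S T i = (if i = r then 0 else if i \<notin> S then 1 else if i \<notin> T then 2 else 3)"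

text \<open>
  The largest set of the chain is tight for every assignment: the capacity entering it is the
  row sum of \<open>r\<close>, and its demand is 1.
\<close>

lemma P_SCF_of_layers:
  fixes x :: "real ^ ('n::finite \<times> 'n)"
  assumes b: "b \<in> Bbar r" and x: "x \<in> P_AP"
    and sub: "T \<subseteq> S" "S \<subseteq> nonroot r"
    and S: "(\<Sum>a\<in>delta_in S. x $ a) = (\<Sum>i\<in>S. b i)"
    and T: "(\<Sum>a\<in>delta_in T. x $ a) = (\<Sum>i\<in>T. b i)"
    and slack: "\<And>i j. i \<noteq> j \<Longrightarrow> layer r S T i = layer r S T j \<Longrightarrow>
        residual (layer r S T) b x j - residual (layer r S T) b x i
          \<le> card {k. layer r S T k = layer r S T i} * x $ (i, j)"
  shows "x \<in> P_SCF r b"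
proof (rule P_SCF_of_tight_chain[where l = "layer r S T", OF x])
  show "0 < layer r S T i" if "i \<noteq> r" for i
    using that by (simp add: layer_def)
next
  fix k :: nat
  assume "0 < k"
  then consider "k = 1" | "k = 2" | "k = 3" | "3 < k"
    by linarith
  then show "(\<Sum>a\<in>delta_in {i. k \<le> layer r S T i}. x $ a) = (\<Sum>i | k \<le> layer r S T i. b i)"
  proof cases
    case 1
    have "{i. k \<le> layer r S T i} = nonroot r"
      using 1 by (auto simp: layer_def nonroot_def)
    moreover have "delta_in (nonroot r) = delta_out {r}"
      by (auto simp: delta_in_Times delta_out_Times nonroot_def)
    ultimately show ?thesis
      using x b by (simp add: P_AP_eq assignment_flat_def Bbar_def)
  next
    case 2
    then have "{i. k \<le> layer r S T i} = S"
      using sub by (auto simp: layer_def nonroot_def)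
    then show ?thesis
      using S by simp
  next
    case 3
    then have "{i. k \<le> layer r S T i} = T"
      using sub by (auto simp: layer_def nonroot_def)
    then show ?thesis
      using T by simp
  next
    case 4
    then have none: "{i. k \<le> layer r S T i} = {}"
      by (auto simp: layer_def)
    show ?thesis
      unfolding none by (simp add: delta_in_def)
  qed
qed (rule slack)

lemma sum_if_mem:
  fixes p q :: real and S :: "'n::finite set"
  shows "(\<Sum>j\<in>UNIV. if j \<in> S then p else q) = card S * p + card (- S) * q"
  by (simp add: sum.If_cases)

text \<open>
  The uniform assignment exceeds every nontrivial cut bound, so it lies outside all the proper
  faces considered below. The chain used here has the set of all nodes but \<open>r\<close> as its only nonempty
  member.
\<close>

lemma uniform_point:
  fixes r :: "'n::finite"
  assumes b: "b \<in> Bbar r" and n: "CARD('n) \<ge> 2"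
  shows "arc_vector (\<lambda>_ _. 1 / (real CARD('n) - 1)) \<in> P_SCF r b" (is "?u \<in> _")
proof (rule P_SCF_of_layers[OF b, of _ "{}" "{}"])
  show "?u \<in> P_AP"
    using n by (intro arc_vector_in_P_AP) (auto simp: field_simps)
  fix i j :: 'n
  assume ij: "i \<noteq> j" "layer r {} {} i = layer r {} {} j"
  then have nr: "i \<noteq> r" "j \<noteq> r"
    by (auto simp: layer_def split: if_splits)
  have "{k. layer r {} {} k = layer r {} {} i} = UNIV - {r}"
    using nr by (auto simp: layer_def)
  then have "real (card {k. layer r {} {} k = layer r {} {} i}) = real CARD('n) - 1"
    using n by (simp add: card_Diff_singleton)
  moreover have "residual (layer r {} {}) b ?u j - residual (layer r {} {}) b ?u i = b j - b i"
    using ij nr by (intro residual_diff) (auto simp: arc_vector_nth)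
  moreover have "0 \<le> b i" "b j \<le> 1"
    using Bbar_le_sum[OF b, of "nonroot r"] b nr by (auto simp: Bbar_def nonroot_def)
  ultimately show "residual (layer r {} {}) b ?u j - residual (layer r {} {}) b ?u i
      \<le> card {k. layer r {} {} k = layer r {} {} i} * ?u $ (i, j)"
    using n ij by (simp add: arc_vector_nth)
qed (auto simp: delta_in_def)

text \<open>
  With \<open>s\<close> nodes on one side and \<open>m\<close> on the other, the cut value is \<open>s m / (s + m - 1)\<close>, and
  \<open>s m - (s + m - 1) = (s - 1) (m - 1)\<close>.
\<close>

lemma cut_of_uniform_point:
  fixes S :: "'n::finite set"
  assumes "2 \<le> card S" "2 \<le> card (- S)"
  shows "(\<Sum>a\<in>delta_out S. arc_vector (\<lambda>_ _. 1 / (real CARD('n) - 1)) $ a) > 1"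
proof -
  define s m where "s = real (card S)" and "m = real (card (- S))"
  have n: "real CARD('n) = s + m"
    unfolding s_def m_def by (metis Compl_partition Compl_disjoint card_Un_disjoint finite of_nat_add)
  have sm: "2 \<le> s" "2 \<le> m"
    using assms by (simp_all add: s_def m_def)
  have "0 < (s - 1) * (m - 1)"
    using sm by simp
  then have "s + m - 1 < s * m"
    by (simp add: algebra_simps)
  then have "1 < s * m / (s + m - 1)"
    using sm by simp
  moreover have "(\<Sum>a\<in>delta_out S. arc_vector (\<lambda>_ _. 1 / (real CARD('n) - 1)) $ a)
      = (\<Sum>i\<in>S. \<Sum>j\<in>-S. 1 / (s + m - 1))"
    unfolding sum_delta_out n by (intro sum.cong refl) (auto simp: arc_vector_nth)
  ultimately show ?thesis
    by (simp add: s_def m_def)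
qed

text \<open>
  For \<open>W\<close> the set of nodes outside \<open>S\<close> and different from \<open>r\<close>, one unit of \<open>x\<close> goes from \<open>r\<close> to \<open>S\<close>, from
  \<open>S\<close> to \<open>W\<close> and from \<open>W\<close> to \<open>r\<close>, evenly spread, and constants inside \<open>S\<close> and inside \<open>W\<close> complete it to
  an assignment. All the demand lies in \<open>W\<close>, so \<open>W\<close> is tight and serves as the second set of the chain.
\<close>

lemma cyclic_block_point:
  fixes r :: "'n::finite" and S :: "'n set"
  assumes b: "b \<in> Bbar r" and S: "S \<subseteq> nonroot r" "S \<noteq> {}" "S \<noteq> nonroot r"
    and zero: "(\<Sum>i\<in>S. b i) = 0"
  obtains x where "x \<in> P_SCF r b" "(\<Sum>i\<in>S. x $ (i, r)) = 0" "(\<Sum>a\<in>delta_out S. x $ a) = 1"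
proof -
  define W where "W = nonroot r - S"
  define s w where "s = real (card S)" and "w = real (card W)"
  have W: "W \<noteq> {}" "r \<notin> W" "r \<notin> S" "W \<inter> S = {}" and compl: "- S = insert r W" "- W = insert r S"
    using S by (auto simp: W_def nonroot_def)
  have pos: "0 < s" "0 < w"
    using S W by (auto simp: s_def w_def card_gt_0_iff)
  have all: "(\<Sum>j\<in>UNIV. h j) = (\<Sum>j\<in>S. h j) + (\<Sum>j\<in>W. h j) + h r" for h :: "'n \<Rightarrow> real"
  proof -
    have "(UNIV :: 'n set) = insert r (S \<union> W)"
      using compl by auto
    then have "(\<Sum>j\<in>UNIV. h j) = (\<Sum>j\<in>insert r (S \<union> W). h j)"
      by simp
    also have "\<dots> = (\<Sum>j\<in>S. h j) + (\<Sum>j\<in>W. h j) + h r"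
      using W by (simp add: sum.union_disjoint Int_commute)
    finally show ?thesis .
  qed
  define g where "g i j =
    (if i \<in> S then if j \<in> S then 1 / s else if j \<in> W then 1 / (s * w) else 0
     else if i \<in> W then if j \<in> S then 0 else 1 / w
     else if j \<in> S then 1 / s else 0)" for i j
  define x where "x = arc_vector g"
  have notS: "j \<in> W \<Longrightarrow> j \<notin> S" for j
    using W by auto
  have x_AP: "x \<in> P_AP"
    unfolding x_def
  proof (rule arc_vector_in_P_AP)
    show "0 \<le> g i j" for i j
      using pos by (simp add: g_def)
    show "(\<Sum>j\<in>UNIV. g i j) = 1 + g i i" "(\<Sum>j\<in>UNIV. g j i) = 1 + g i i" for i
      using pos W notS by (auto simp: all g_def simp flip: s_def w_def)
  qed
  have x_nth: "x $ (i, j) = g i j" if "i \<noteq> j" for i j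
    using that by (simp add: x_def arc_vector_nth)
  have into_W: "(\<Sum>j\<in>W. x $ (i, j)) = (\<Sum>j\<in>W. g i j)" if "i \<notin> W" for i
    using that by (intro sum.cong refl x_nth) auto
  have to_root_zero: "x $ (i, r) = 0" if "i \<in> S" for i
  proof -
    have "i \<noteq> r"
      using that W by auto
    then show ?thesis
      using that W by (simp add: x_nth g_def)
  qed
  have sumS: "(\<Sum>a\<in>delta_out S. x $ a) = (\<Sum>i\<in>S. \<Sum>j\<in>W. g i j)"
    unfolding sum_delta_out compl
  proof (rule sum.cong[OF refl])
    fix i
    assume i: "i \<in> S"
    show "(\<Sum>j\<in>insert r W. x $ (i, j)) = (\<Sum>j\<in>W. g i j)"
      using W into_W[of i] notS i to_root_zero[OF i] by auto
  qed
  have cut1: "(\<Sum>a\<in>delta_out S. x $ a) = 1"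
    unfolding sumS using pos notS by (simp add: g_def flip: s_def w_def)
  have to_root: "(\<Sum>i\<in>S. x $ (i, r)) = 0"
    by (simp add: to_root_zero)
  have b_zero: "b i = 0" if "i \<in> S" for i
    using Bbar_le_sum[OF b S(1) that] zero by simp
  have b_W: "(\<Sum>i\<in>W. b i) = 1"
  proof -
    have "(\<Sum>i\<in>nonroot r. b i) = (\<Sum>i\<in>W. b i) + (\<Sum>i\<in>S. b i)"
      unfolding W_def by (rule sum.subset_diff) (use S in auto)
    then show ?thesis
      using b zero by (simp add: Bbar_def)
  qed
  have "x \<in> P_SCF r b"
  proof (rule P_SCF_of_layers[OF b x_AP, of "{}" W])
    show "W \<subseteq> nonroot r"
      by (auto simp: W_def)
    show "(\<Sum>a\<in>delta_in W. x $ a) = (\<Sum>i\<in>W. b i)"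
    proof -
      have "(\<Sum>a\<in>delta_in W. x $ a) = (\<Sum>i\<in>S. \<Sum>j\<in>W. g i j) + (\<Sum>j\<in>W. g r j)"
      proof -
        have "(\<Sum>i\<in>S. \<Sum>j\<in>W. x $ (i, j)) = (\<Sum>i\<in>S. \<Sum>j\<in>W. g i j)"
          using notS by (intro sum.cong[OF refl] into_W) auto
        then show ?thesis
          unfolding sum_delta_in compl using W by (simp add: into_W)
      qed
      also have "\<dots> = 1"
      proof -
        have "(\<Sum>j\<in>W. g r j) = 0"
          using W notS by (simp add: g_def)
        then show ?thesis
          using cut1 unfolding sumS by linarith
      qed
      finally show ?thesis
        using b_W by simp
    qed
    fix i j
    assume ij: "i \<noteq> j" "layer r W {} i = layer r W {} j"
    have nr: "i \<noteq> r" "j \<noteq> r" and same_W: "i \<in> W \<longleftrightarrow> j \<in> W"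
      using ij by (auto simp: layer_def split: if_splits)
    then have same_S: "i \<in> S \<longleftrightarrow> j \<in> S"
      using compl by blast
    have diff: "residual (layer r W {}) b x j - residual (layer r W {}) b x i = b j - b i"
    proof (rule residual_diff[OF ij(2)])
      fix k
      assume "layer r W {} k \<noteq> layer r W {} i"
      then have "k \<noteq> i" "k \<noteq> j"
        using ij by auto
      moreover have "g k i = g k j" "g i k = g j k"
        by (simp_all add: g_def same_W same_S)
      ultimately show "x $ (k, i) = x $ (k, j) \<and> x $ (i, k) = x $ (j, k)"
        by (simp add: x_nth)
    qed
    consider "i \<in> S" "j \<in> S" | "i \<in> W" "j \<in> W"
      using same_W same_S nr compl by blast
    then show "residual (layer r W {}) b x j - residual (layer r W {}) b x i
        \<le> card {k. layer r W {} k = layer r W {} i} * x $ (i, j)"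
    proof cases
      case 1
      then show ?thesis
        using pos ij by (simp add: diff b_zero x_nth g_def)
    next
      case 2
      have lev: "layer r W {} k = 2 \<longleftrightarrow> k \<in> W" for k
        using W by (simp add: layer_def)
      then have lev_i: "layer r W {} i = 2"
        using 2 by blast
      have "{k. layer r W {} k = layer r W {} i} = W"
        unfolding lev_i lev by simp
      moreover have "b j \<le> 1" "0 \<le> b i"
        using Bbar_le_sum[OF b, of W] b_W 2 by (auto simp: W_def)
      ultimately show ?thesis
        using 2 pos ij notS by (simp add: diff x_nth g_def flip: w_def)
    qed
  qed (auto simp: delta_in_def)
  then show thesis
    using to_root cut1 by (rule that)
qed

text \<open>
  The strict form of the conditions of \<open>P_SCF_of_layers\<close>, an open condition on \<open>x\<close>. The smallest
  set of the chain is empty or a single node \<open>i\<close> of \<open>S\<close> with \<open>b i = 1\<close>. Such a node has to form a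
  layer of its own: its balance forces the flow to saturate the arcs entering it and to
  avoid the arcs leaving it, so that no slack would be left if it shared a layer with others.
\<close>

definition strictly_slack :: "'n \<Rightarrow> 'n set \<Rightarrow> ('n \<Rightarrow> real) \<Rightarrow> real ^ ('n::finite \<times> 'n) \<Rightarrow> bool" where
  "strictly_slack r S b x \<longleftrightarrow> (let l = layer r S {i \<in> S. b i = 1} in
     \<forall>i j. i \<noteq> j \<longrightarrow> 0 < x $ (i, j) \<and> (l i = l j \<longrightarrow>
       residual l b x j - residual l b x i < card {k. l k = l i} * x $ (i, j)))"

text \<open>
  The assignment equations and tightness determine the values \<open>\<alpha>\<close> inside \<open>S\<close>, \<open>\<beta>\<close> inside the
  complement and \<open>\<gamma>\<close> across. The slack inside the complement rests on \<open>b j \<le> 1 - b(S) < 1 - b(S) / m\<close>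
  for the nodes \<open>j\<close> outside \<open>S\<close> and different from \<open>r\<close>, where \<open>m\<close> is the size of the complement.
  Inside \<open>S\<close>, with \<open>s\<close> nodes, the capacity \<open>s \<alpha>\<close>
  is \<open>(s - b(S)) / (s - 1)\<close>. It is at least 1, with equality only for \<open>b(S) = 1\<close>, and so suffices unless
  a single node carries the whole demand; in that case all other demands vanish.
\<close>

lemma interior_block_point:
  fixes r :: "'n::finite" and S :: "'n set"
  assumes b: "b \<in> Bbar r" and S: "S \<subseteq> nonroot r" and size: "2 \<le> card S" "2 \<le> card (- S)"
    and pos: "0 < (\<Sum>i\<in>S. b i)"
  obtains x where "x \<in> P_AP" "(\<Sum>a\<in>delta_out S. x $ a) = (\<Sum>i\<in>S. b i)"
    "strictly_slack r S b x"
proof -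
  define l where "l = layer r S {i \<in> S. b i = 1}"
  define \<theta> where "\<theta> = (\<Sum>i\<in>S. b i)"
  define s m where "s = real (card S)" and "m = real (card (- S))"
  define \<alpha> \<beta> \<gamma> where "\<alpha> = (1 - \<theta> / s) / (s - 1)" and "\<beta> = (1 - \<theta> / m) / (m - 1)"
    and "\<gamma> = \<theta> / (s * m)"
  have sm: "2 \<le> s" "2 \<le> m"
    using size by (simp_all add: s_def m_def)
  have \<theta>: "0 < \<theta>" "\<theta> \<le> 1"
    using pos Bbar_sum_bounds[OF b S] by (simp_all add: \<theta>_def)
  have \<alpha>: "0 < \<alpha>" "s * \<alpha> + m * \<gamma> = 1 + \<alpha>"
    using sm \<theta> by (simp_all add: \<alpha>_def \<gamma>_def field_simps)
  have \<beta>: "0 < \<beta>" "s * \<gamma> + m * \<beta> = 1 + \<beta>"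
    using sm \<theta> by (simp_all add: \<beta>_def \<gamma>_def field_simps)
  have \<gamma>: "0 < \<gamma>"
    using sm \<theta> by (simp add: \<gamma>_def)
  define g where "g i j = (if i \<in> S then if j \<in> S then \<alpha> else \<gamma> else if j \<in> S then \<gamma> else \<beta>)" for i j
  define x where "x = arc_vector g"
  have g_pos: "0 < g i j" for i j
    using \<alpha> \<beta> \<gamma> by (simp add: g_def)
  have sym: "g i j = g j i" for i j
    by (simp add: g_def)
  have row: "(\<Sum>j\<in>UNIV. g i j) = 1 + g i i" for i
    using \<alpha> \<beta> by (cases "i \<in> S") (simp_all add: g_def sum_if_mem flip: s_def m_def)
  have x_AP: "x \<in> P_AP"
    unfolding x_def
  proof (rule arc_vector_in_P_AP)
    show "0 \<le> g i j" for i j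
      using g_pos less_imp_le by blast
    show "(\<Sum>j\<in>UNIV. g i j) = 1 + g i i" for i
      by (rule row)
    have "(\<Sum>j\<in>UNIV. g j i) = (\<Sum>j\<in>UNIV. g i j)" for i
      by (intro sum.cong refl sym)
    then show "(\<Sum>j\<in>UNIV. g j i) = 1 + g i i" for i
      by (simp add: row)
  qed
  have "(\<Sum>a\<in>delta_out S. x $ a) = (\<Sum>i\<in>S. \<Sum>j\<in>-S. \<gamma>)"
    unfolding sum_delta_out by (intro sum.cong refl) (auto simp: x_def arc_vector_nth g_def)
  then have cut: "(\<Sum>a\<in>delta_out S. x $ a) = (\<Sum>i\<in>S. b i)"
    using sm by (simp add: \<gamma>_def \<theta>_def flip: s_def m_def)
  have x_pos: "0 < x $ (i, j)" if "i \<noteq> j" for i j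
    using g_pos that by (simp add: x_def arc_vector_nth)
  have r: "r \<notin> S"
    using S by (auto simp: nonroot_def)
  have b_bounds: "0 \<le> b i" "b i \<le> \<theta>" if "i \<in> S" for i
    using Bbar_le_sum[OF b S that] by (simp_all add: \<theta>_def)
  have b_pair: "b i + b j \<le> \<theta>" if "i \<in> S" "j \<in> S" "i \<noteq> j" for i j
  proof -
    have "(\<Sum>k\<in>{i, j}. b k) \<le> (\<Sum>k\<in>S. b k)"
      using that b_bounds by (intro sum_mono2) auto
    then show ?thesis
      using that by (simp add: \<theta>_def)
  qed
  have slack: "residual l b x j - residual l b x i < card {k. l k = l i} * x $ (i, j)"
    if ij: "i \<noteq> j" and lev: "l i = l j" for i j
  proof -
    have nr: "i \<noteq> r" "j \<noteq> r"
      using ij lev by (auto simp: l_def layer_def split: if_splits)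
    have diff: "residual l b x j - residual l b x i = b j - b i"
    proof (rule residual_diff[OF lev])
      fix k
      assume k: "l k \<noteq> l i"
      then have "k \<noteq> i" "k \<noteq> j"
        using lev by auto
      moreover have "i \<in> S \<longleftrightarrow> j \<in> S"
        using lev nr by (auto simp: l_def layer_def split: if_splits)
      ultimately show "x $ (k, i) = x $ (k, j) \<and> x $ (i, k) = x $ (j, k)"
        by (auto simp: x_def arc_vector_nth g_def)
    qed
    consider "i \<notin> S" "j \<notin> S" | "i \<in> S" "j \<in> S" "b i \<noteq> 1" "b j \<noteq> 1" | "i \<in> S" "j \<in> S" "b i = 1" "b j = 1"
      using lev nr by (auto simp: l_def layer_def split: if_splits)
    then show ?thesis
    proof cases
      case 1
      have "{k. l k = l i} = (- S) - {r}"
        using 1 nr by (auto simp: l_def layer_def)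
      then have "real (card {k. l k = l i}) = m - 1"
        using r sm by (simp add: m_def card_Diff_singleton of_nat_diff)
      moreover have "b j \<le> 1 - \<theta>"
      proof -
        have "(\<Sum>k\<in>insert j S. b k) \<le> 1"
          using S nr by (intro Bbar_sum_bounds[OF b]) (auto simp: nonroot_def)
        then show ?thesis
          using 1 by (simp add: \<theta>_def)
      qed
      moreover have "0 \<le> b i"
        using Bbar_le_sum[OF b order_refl] nr by (simp add: nonroot_def)
      moreover have "(m - 1) * \<beta> = 1 - \<theta> / m" "\<theta> / m < \<theta>"
        using \<theta> sm by (simp_all add: \<beta>_def divide_less_eq)
      moreover have "x $ (i, j) = \<beta>"
        using 1 ij by (simp add: x_def arc_vector_nth g_def)
      ultimately show ?thesis
        unfolding diff by simp
    next
      case 2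
      have lev2: "{k. l k = l i} = {k \<in> S. b k \<noteq> 1}"
        using 2 nr r by (auto simp: l_def layer_def)
      \<comment> \<open>A node of \<open>S\<close> with demand 1 lies in the layer above and leaves demand 0 for this one;
        without such a node this layer is all of \<open>S\<close>.\<close>
      show ?thesis
      proof (cases "\<exists>k\<in>S. b k = 1")
        case True
        then obtain k where k: "k \<in> S" "b k = 1"
          by blast
        then have "b j = 0"
          using b_pair[of k j] b_bounds[of j] 2 \<theta> by fastforce
        moreover have "0 \<le> b i"
          using b_bounds 2 by simp
        moreover have "0 < card {k. l k = l i} * x $ (i, j)"
        proof (rule mult_pos_pos[OF _ x_pos[OF ij]])
          show "0 < real (card {k. l k = l i})"
            by (auto simp: card_gt_0_iff)
        qed
        ultimately show ?thesis
          unfolding diff by linarith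
      next
        case False
        then have "{k \<in> S. b k \<noteq> 1} = S"
          by blast
        then have "card {k. l k = l i} * x $ (i, j) = s * \<alpha>"
          using lev2 2 ij by (simp add: s_def x_def arc_vector_nth g_def)
        moreover have "b j - b i < s * \<alpha>"
        proof (cases "\<theta> = 1")
          case True
          have "s * \<alpha> = 1"
            using True sm by (simp add: \<alpha>_def field_simps)
          then show ?thesis
            using b_bounds[of i] b_bounds[of j] 2 True by fastforce
        next
          case False
          have "1 < s * \<alpha>"
            using False \<theta> sm by (simp add: \<alpha>_def field_simps)
          then show ?thesis
            using b_bounds[of i] b_bounds[of j] 2 \<theta> by linarith
        qed
        ultimately show ?thesis
          by (simp add: diff)
      qed
    next
      case 3
      then show ?thesis
        using b_pair[of i j] ij \<theta> by simp
    qed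
  qed
  have "strictly_slack r S b x"
    unfolding strictly_slack_def Let_def using x_pos slack by (simp add: l_def)
  with x_AP cut show thesis
    by (rule that)
qed

lemma tendsto_residual:
  assumes "(X \<longlongrightarrow> x) F"
  shows "((\<lambda>t. residual l b (X t) i) \<longlongrightarrow> residual l b x i) F"
  unfolding residual_def using assms by (intro tendsto_intros)

section \<open>The facet and the smaller faces\<close>

text \<open>
  Tightness of the whole chain is preserved exactly along the segment, being affine in the
  point: a single node of demand 1 is tight for every assignment. The strict inequalities persist
  near \<open>x\<close> by continuity.
\<close>

lemma segment_enters_P_SCF:
  fixes r :: "'n::finite" and S :: "'n set"
  assumes b: "b \<in> Bbar r" and S: "S \<subseteq> nonroot r"
    and x: "x \<in> assignment_flat" "(\<Sum>a\<in>delta_out S. x $ a) = (\<Sum>i\<in>S. b i)"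
    and y: "y \<in> assignment_flat" "(\<Sum>a\<in>delta_out S. y $ a) = (\<Sum>i\<in>S. b i)"
    and slack: "strictly_slack r S b x"
  shows "\<forall>\<^sub>F t in at_right 0. (1 - t) *\<^sub>R x + t *\<^sub>R y \<in> P_SCF r b"
proof -
  define T where "T = {i \<in> S. b i = 1}"
  define l where "l = layer r S T"
  define X where "X t = (1 - t) *\<^sub>R x + t *\<^sub>R y" for t
  have X_lim: "(X \<longlongrightarrow> x) (at_right 0)"
    unfolding X_def by (rule tendsto_eq_intros refl | simp)+
  have X_flat: "X t \<in> assignment_flat" for t
    using mem_affine[OF affine_assignment_flat x(1) y(1), of "1 - t" t] by (simp add: X_def)
  have X_cut: "(\<Sum>a\<in>delta_out S. X t $ a) = (\<Sum>i\<in>S. b i)" for t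
  proof -
    have "(\<Sum>a\<in>delta_out S. X t $ a) = (1 - t) * (\<Sum>a\<in>delta_out S. x $ a) + t * (\<Sum>a\<in>delta_out S. y $ a)"
      by (simp add: X_def sum.distrib sum_distrib_left)
    also have "\<dots> = (\<Sum>i\<in>S. b i)"
      unfolding x(2) y(2) by (simp add: algebra_simps)
    finally show ?thesis .
  qed
  have T_cut: "(\<Sum>a\<in>delta_in T. X t $ a) = (\<Sum>i\<in>T. b i)" for t
  proof (cases "T = {}")
    case True
    then show ?thesis
      by (simp add: delta_in_def)
  next
    case False
    then obtain k where k: "k \<in> T"
      by blast
    have "i = k" if i: "i \<in> T" for i
    proof (rule ccontr)
      assume "i \<noteq> k"
      moreover have "(\<Sum>i\<in>{i, k}. b i) \<le> 1"
        using i k S by (intro Bbar_sum_bounds[OF b]) (auto simp: T_def)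
      ultimately show False
        using i k by (simp add: T_def)
    qed
    then have "T = {k}"
      using k by blast
    moreover have "b k = 1"
      using k by (simp add: T_def)
    ultimately show ?thesis
      using X_flat[of t] by (simp add: assignment_flat_def)
  qed
  have "\<forall>\<^sub>F t in at_right 0. \<forall>i j. i \<noteq> j \<longrightarrow> 0 < X t $ (i, j)"
  proof (intro eventually_all_finite)
    fix i j :: 'n
    have "\<forall>\<^sub>F t in at_right 0. 0 < X t $ (i, j)" if "i \<noteq> j"
      using tendsto_vec_nth[OF X_lim] slack that
      by (intro order_tendstoD(1)[of _ "x $ (i, j)"]) (auto simp: strictly_slack_def Let_def)
    then show "\<forall>\<^sub>F t in at_right 0. i \<noteq> j \<longrightarrow> 0 < X t $ (i, j)"
      by (cases "i = j") auto
  qed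
  moreover have "\<forall>\<^sub>F t in at_right 0. \<forall>i j. i \<noteq> j \<longrightarrow> l i = l j \<longrightarrow>
    0 < card {k. l k = l i} * X t $ (i, j) - (residual l b (X t) j - residual l b (X t) i)"
  proof (intro eventually_all_finite)
    fix i j :: 'n
    have "\<forall>\<^sub>F t in at_right 0.
        0 < card {k. l k = l i} * X t $ (i, j) - (residual l b (X t) j - residual l b (X t) i)"
      if "i \<noteq> j" "l i = l j"
    proof (rule order_tendstoD)
      show "((\<lambda>t. card {k. l k = l i} * X t $ (i, j) - (residual l b (X t) j - residual l b (X t) i))
        \<longlongrightarrow> card {k. l k = l i} * x $ (i, j) - (residual l b x j - residual l b x i)) (at_right 0)"
        by (intro tendsto_intros tendsto_residual X_lim)
      show "0 < card {k. l k = l i} * x $ (i, j) - (residual l b x j - residual l b x i)"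
        using slack that by (simp add: strictly_slack_def Let_def l_def T_def)
    qed
    then show "\<forall>\<^sub>F t in at_right 0. i \<noteq> j \<longrightarrow> l i = l j \<longrightarrow>
        0 < card {k. l k = l i} * X t $ (i, j) - (residual l b (X t) j - residual l b (X t) i)"
      by (cases "i \<noteq> j \<and> l i = l j") auto
  qed
  ultimately have "\<forall>\<^sub>F t in at_right 0. X t \<in> P_SCF r b"
  proof eventually_elim
    case (elim t)
    show ?case
    proof (rule P_SCF_of_layers[OF b _ _ S, of _ T])
      have "0 \<le> X t $ (i, j)" for i j
        using elim(1) X_flat[of t]
        by (cases "i = j") (auto simp: assignment_flat_def arc_space_def arcs_def less_imp_le)
      then show "X t \<in> P_AP"
        using X_flat by (simp add: P_AP_eq)
      show "T \<subseteq> S"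
        by (auto simp: T_def)
      show "(\<Sum>a\<in>delta_in S. X t $ a) = (\<Sum>i\<in>S. b i)"
        using cut_symmetric[OF X_flat] X_cut by simp
      show "(\<Sum>a\<in>delta_in T. X t $ a) = (\<Sum>i\<in>T. b i)"
        by (rule T_cut)
      show "residual (layer r S T) b (X t) j - residual (layer r S T) b (X t) i
          \<le> card {k. layer r S T k = layer r S T i} * X t $ (i, j)"
        if "i \<noteq> j" "layer r S T i = layer r S T j" for i j
        using elim(2)[rule_format, of i j] that by (simp add: l_def)
    qed
  qed
  then show ?thesis
    by (simp add: X_def)
qed

text \<open>
  If from one tight point \<open>x\<close> of \<open>P\<close> the segments towards all points \<open>y\<close> of the hyperplane section of
  the affine hull start inside \<open>P\<close>, then each such \<open>y\<close> is an affine combination of two tight points of \<open>P\<close>, so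
  the tight face spans the section. The point \<open>u\<close> makes the section proper.
\<close>

lemma facet_of_supporting_hyperplane:
  fixes P :: "'a::euclidean_space set"
  assumes P: "convex P" and valid: "\<And>x. x \<in> P \<Longrightarrow> \<beta> \<le> a \<bullet> x"
    and "x \<in> P" "a \<bullet> x = \<beta>" and "u \<in> P" "a \<bullet> u \<noteq> \<beta>"
    and segment: "\<And>y. y \<in> affine hull P \<Longrightarrow> a \<bullet> y = \<beta> \<Longrightarrow>
      \<forall>\<^sub>F t in at_right 0. (1 - t) *\<^sub>R x + t *\<^sub>R y \<in> P"
  shows "(P \<inter> {x. a \<bullet> x = \<beta>}) facet_of P"
proof -
  let ?H = "{x. a \<bullet> x = \<beta>}"
  let ?F = "P \<inter> ?H"
  have face: "?F face_of P"
    using P valid by (rule face_of_Int_supporting_hyperplane_ge)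
  have "?F \<subseteq> affine hull P \<inter> ?H"
    using hull_subset[of P affine] by blast
  moreover have "affine hull P \<inter> ?H \<subseteq> affine hull ?F"
  proof
    fix y
    assume y: "y \<in> affine hull P \<inter> ?H"
    have "\<forall>\<^sub>F t in at_right (0::real). 0 < t \<and> (1 - t) *\<^sub>R x + t *\<^sub>R y \<in> P"
      using y by (intro eventually_conj segment eventually_at_right_less) auto
    then obtain t :: real where t: "0 < t" "(1 - t) *\<^sub>R x + t *\<^sub>R y \<in> P"
      using eventually_happens'[of "at_right (0::real)"] by auto
    let ?z = "(1 - t) *\<^sub>R x + t *\<^sub>R y"
    have "a \<bullet> ?z = \<beta>"
      using y assms(4) by (simp add: inner_add_right algebra_simps)
    then have "?z \<in> affine hull ?F" "x \<in> affine hull ?F"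
      using t assms(3,4) by (auto intro: hull_inc)
    then have "(1 - 1 / t) *\<^sub>R x + (1 / t) *\<^sub>R ?z \<in> affine hull ?F"
      by (intro mem_affine[OF affine_affine_hull, of x _ ?z]) simp_all
    moreover have "(1 - 1 / t) *\<^sub>R x + (1 / t) *\<^sub>R ?z = y"
    proof -
      have "(1 - 1 / t) *\<^sub>R x + (1 / t) *\<^sub>R ?z
          = (1 - 1 / t + 1 / t * (1 - t)) *\<^sub>R x + (1 / t * t) *\<^sub>R y"
        by (simp only: scaleR_add_right scaleR_add_left scaleR_scaleR add.assoc)
      moreover have "1 - 1 / t + 1 / t * (1 - t) = 0"
        using t by (simp add: field_simps)
      ultimately show ?thesis
        using t by simp
    qed
    ultimately show "y \<in> affine hull ?F"
      by simp
  qed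
  ultimately have "aff_dim ?F = aff_dim (affine hull P \<inter> ?H)"
    by (metis aff_dim_affine_hull aff_dim_subset order_antisym)
  moreover have "affine hull P \<inter> ?H \<noteq> {}" "\<not> affine hull P \<subseteq> ?H"
    using assms(3-6) hull_inc[of _ P affine] by auto
  ultimately have "aff_dim ?F = aff_dim P - 1"
    by (simp add: aff_dim_affine_Int_hyperplane)
  then show ?thesis
    using face assms(3,4) by (auto simp: facet_of_def)
qed

lemma not_facet_of_strict_subface:
  fixes P :: "'a::euclidean_space set"
  assumes "convex P" "F face_of P" "G face_of P" "F \<subset> G" "G \<noteq> P"
  shows "\<not> F facet_of P"
proof -
  have "F face_of G"
    using assms by (meson face_of_imp_subset face_of_subset psubset_imp_subset)
  then have "aff_dim F < aff_dim G"
    using assms by (intro face_of_aff_dim_lt) (auto intro: face_of_imp_convex)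
  moreover have "aff_dim G < aff_dim P"
    using assms by (intro face_of_aff_dim_lt) auto
  ultimately show ?thesis
    by (auto simp: facet_of_def)
qed

section \<open>The characterization\<close>

theorem proposition28:
  fixes r :: "'n::finite" and b :: "'n \<Rightarrow> real" and S :: "'n set"
  assumes "CARD('n) \<ge> 4"
    and "b \<in> Bbar r"
    and "S \<in> S1_sets r"
  shows "defines_facet (\<lambda>x. \<Sum>a\<in>delta_out S. x $ a) (\<Sum>i\<in>S. b i) (P_SCF r b)
     \<longleftrightarrow> (\<Sum>i\<in>S. b i) > 0 \<and> S \<noteq> nonroot r"
proof -
  let ?P = "P_SCF r b" and ?L = "\<lambda>x :: real ^ ('n \<times> 'n). \<Sum>a\<in>delta_out S. x $ a"
    and ?\<beta> = "\<Sum>i\<in>S. b i"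
  let ?F = "{x \<in> ?P. ?L x = ?\<beta>}"
  have S: "S \<subseteq> nonroot r" "2 \<le> card S" "S \<noteq> {}"
    using assms(3) by (auto simp: S1_sets_def)
  have valid: "?\<beta> \<le> ?L x" if "x \<in> ?P" for x
    using that S(1) by (rule cut_valid)
  have lin: "linear ?L"
    by (intro linearI) (simp_all add: sum.distrib sum_distrib_left)
  define c :: "real ^ ('n \<times> 'n)" where "c = (\<chi> a. if a \<in> delta_out S then 1 else 0)"
  have c: "c \<bullet> x = ?L x" for x
    by (simp add: c_def inner_vec_def sum.If_cases if_distrib[of "\<lambda>t. t * _"] cong: if_cong)
  have F_eq: "?F = ?P \<inter> {x. c \<bullet> x = ?\<beta>}"
    by (auto simp: c)
  have F_face: "?F face_of ?P"
    unfolding F_eq using convex_P_SCF valid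
    by (intro face_of_Int_supporting_hyperplane_ge) (auto simp: c)
  have n2: "2 \<le> CARD('n)"
    using assms(1) by simp
  note u = uniform_point[OF assms(2) n2]
  show ?thesis
  proof (cases "S = nonroot r")
    case True
    have "delta_in S = delta_out {r}"
      using True by (auto simp: delta_in_Times delta_out_Times nonroot_def)
    then have "?L x = 1" if "x \<in> ?P" for x
      using that P_SCF_subset[of r b] cut_symmetric[of x S]
      by (auto simp: P_AP_eq assignment_flat_def)
    then have "?F = ?P"
      using True assms(2) by (auto simp: Bbar_def)
    then show ?thesis
      using True by (simp add: defines_facet_def facet_of_irrefl)
  next
    case False
    have "2 \<le> card (- S)"
    proof -
      obtain k where "k \<notin> S" "k \<noteq> r"
        using False S(1) by (auto simp: nonroot_def)
      then have "{k, r} \<subseteq> - S" "card {k, r} = 2"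
        using S(1) by (auto simp: nonroot_def)
      then show ?thesis
        by (metis card_mono finite)
    qed
    note cut_u = cut_of_uniform_point[OF S(2) this]
    show ?thesis
    proof (cases "0 < ?\<beta>")
      case True
      obtain x where x: "x \<in> P_AP" "?L x = ?\<beta>" "strictly_slack r S b x"
        using interior_block_point[OF assms(2) S(1,2) \<open>2 \<le> card (- S)\<close> True] .
      have x_flat: "x \<in> assignment_flat"
        using x(1) by (simp add: P_AP_eq)
      note segment = segment_enters_P_SCF[OF assms(2) S(1) x_flat x(2) _ _ x(3)]
      have "?P \<subseteq> assignment_flat"
        using P_SCF_subset by (auto simp: P_AP_eq)
      then have hull: "affine hull ?P \<subseteq> assignment_flat"
        using affine_assignment_flat by (rule hull_minimal)
      have x_P: "x \<in> ?P"
        using eventually_happens'[OF _ segment[OF x_flat x(2)]] by (auto simp flip: scaleR_left.add)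
      have "?F facet_of ?P"
        unfolding F_eq
      proof (rule facet_of_supporting_hyperplane[OF convex_P_SCF _ x_P _ u])
        show "c \<bullet> arc_vector (\<lambda>_ _. 1 / (real CARD('n) - 1)) \<noteq> ?\<beta>"
          using cut_u Bbar_sum_bounds[OF assms(2) S(1)] by (simp add: c)
      qed (use valid x(2) segment hull in \<open>auto simp: c\<close>)
      then show ?thesis
        using True False lin valid by (simp add: defines_facet_def)
    next
      case not_pos: False
      then have zero: "?\<beta> = 0"
        using Bbar_sum_bounds[OF assms(2) S(1)] by simp
      \<comment> \<open>The intermediate face \<open>?G\<close> consists of the points that vanish on the arcs from \<open>S\<close> to \<open>r\<close>.\<close>
      let ?d = "(\<chi> a. if a \<in> S \<times> {r} then 1 else 0) :: real ^ ('n \<times> 'n)"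
      have d: "?d \<bullet> x = (\<Sum>i\<in>S. x $ (i, r))" for x
      proof -
        have "?d \<bullet> x = (\<Sum>a\<in>S \<times> {r}. x $ a)"
          by (simp add: inner_vec_def sum.If_cases if_distrib[of "\<lambda>t. t * _"] cong: if_cong)
        also have "\<dots> = (\<Sum>i\<in>S. \<Sum>j\<in>{r}. x $ (i, j))"
          by (simp only: sum.cartesian_product) simp
        finally show ?thesis
          by simp
      qed
      let ?G = "?P \<inter> {x. ?d \<bullet> x = 0}"
      have nonneg: "0 \<le> x $ a" if "x \<in> ?P" for x a
        using that P_SCF_subset unfolding P_AP_eq by blast
      have G_face: "?G face_of ?P"
        using convex_P_SCF nonneg
        by (intro face_of_Int_supporting_hyperplane_ge) (auto simp: d intro!: sum_nonneg)
      have r: "r \<notin> S"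
        using S(1) by (auto simp: nonroot_def)
      have "x $ (i, r) = 0" if "x \<in> ?F" "i \<in> S" for x i
      proof -
        have "(i, r) \<in> delta_out S"
          using that r by (simp add: delta_out_Times)
        moreover have "?L x = 0" "x \<in> ?P"
          using that(1) zero by simp_all
        ultimately show ?thesis
          using nonneg by (intro sum_nonneg_0[of "delta_out S" "\<lambda>a. x $ a"]) auto
      qed
      then have "?F \<subseteq> ?G"
        by (auto simp: d)
      moreover obtain y where "y \<in> ?P" "(\<Sum>i\<in>S. y $ (i, r)) = 0" "?L y = 1"
        using cyclic_block_point[OF assms(2) S(1,3) False zero] .
      then have "y \<in> ?G" "y \<notin> ?F"
        using zero by (auto simp: d)
      ultimately have "?F \<subset> ?G"
        by blast
      moreover have "?G \<noteq> ?P"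
      proof -
        have "0 < (\<Sum>i\<in>S. arc_vector (\<lambda>_ _. 1 / (real CARD('n) - 1)) $ (i, r))"
          using S(3) r assms(1) by (intro sum_pos) (auto simp: arc_vector_nth)
        then have "arc_vector (\<lambda>_ _. 1 / (real CARD('n) - 1)) \<notin> ?G"
          by (simp add: d)
        then show ?thesis
          using u by blast
      qed
      ultimately have "\<not> ?F facet_of ?P"
        using convex_P_SCF F_face G_face by (intro not_facet_of_strict_subface)
      then show ?thesis
        using not_pos by (simp add: defines_facet_def)
    qed
  qed
qed

end
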